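(* Let $n\ge 4$ be even, let $m=n-2$, and let $A=A_\mu^{(n)}=(a_{i,j})$ be the fundamental harmonic matrix of order $n$. Define the $m\times m$ matrix $H=\mathcal{R}_\mu(A)$ by $H_{i,j}=a_{i,j}$ if $i+j\le m+1$ and $H_{i,j}=a_{i+2,j+2}$ if $i+j\ge m+2$ (for $1\le i,j\le m$). Then $H$ is a harmonic matrix of order $m$, and $H\cong A_\mu^{(n-2)}$.
   Context: Let $[n]=\{1,\dots,n\}$. A matrix $M=(m_{i,j})\in[n]^{n\times n}$ is harmonic if each row is a permutation of $[n]$ and the collection of horizontally adjacent pairs $(m_{i,j},m_{i,j+1})$ ($1\le i\le n$, $1\le j\le n-1$) contains each ordered pair $(a,b)$ with $a\ne b$ exactly once. Two $n\times n$ harmonic matrices $M,N$ are isomorphic, $M\cong N$, if there exist permutations $\sigma,\tau$ of $[n]$ with $N_{\tau(i),j}=\sigma(m_{i,j})$ for all $i,j$ (relabeling of symbols plus reordering of rows). For even $n\ge2$, let $f$ be the permutation of $[n]$ given by $f(1)=2$, $f(n)=n-1$, and for $1<i<n$: $f(i)=i+2$ if $i$ is even and $f(i)=i-2$ if $i$ is odd. The fundamental harmonic matrix $A_\mu^{(n)}$ is the $n\times n$ matrix whose $k$-th row is $(f^{e_k}(1),f^{e_k}(2),\dots,f^{e_k}(n))$, where $e_1=0$, $e_{2t}=t$ and $e_{2t+1}=-t$ (negative exponents meaning powers of $f^{-1}$), for $k=1,\dots,n$. For example $A_\mu^{(2)}$ has rows $(1,2),(2,1)$ and $A_\mu^{(4)}$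 has rows $(1,2,3,4),(2,4,1,3),(3,1,4,2),(4,3,2,1)$. The operator $\mathcal{R}_\mu$ corresponds to deleting the band of entries $(i,j)$ with $|i+j-(n+1)|\le 1$ and merging the remaining upper-left triangle and lower-right triangle along the secondary diagonal. *)

theory Defs
  imports "HOL-Combinatorics.Permutations"
begin

text \<open>
  An \<open>n \<times> n\<close> matrix over \<open>[n]\<close> is a function \<open>nat \<Rightarrow> nat \<Rightarrow> nat\<close> with 1-based indices, of which only
  the values at row and column indices in \<open>{1..n}\<close> matter.
\<close>

definition harmonic_matrix :: "nat \<Rightarrow> (nat \<Rightarrow> nat \<Rightarrow> nat) \<Rightarrow> bool" where
  "harmonic_matrix n M \<longleftrightarrow>
     (\<forall>i\<in>{1..n}. bij_betw (M i) {1..n} {1..n}) \<and>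
     (\<forall>a\<in>{1..n}. \<forall>b\<in>{1..n}. a \<noteq> b \<longrightarrow>
        (\<exists>!(i, j). i \<in> {1..n} \<and> j \<in> {1..n - 1} \<and> M i j = a \<and> M i (j + 1) = b))"

definition harmonic_iso ::
    "nat \<Rightarrow> (nat \<Rightarrow> nat \<Rightarrow> nat) \<Rightarrow> (nat \<Rightarrow> nat \<Rightarrow> nat) \<Rightarrow> bool" where
  "harmonic_iso n M N \<longleftrightarrow> harmonic_matrix n M \<and> harmonic_matrix n N \<and>
     (\<exists>\<sigma> \<tau>. \<sigma> permutes {1..n} \<and> \<tau> permutes {1..n} \<and>
        (\<forall>i\<in>{1..n}. \<forall>j\<in>{1..n}. N (\<tau> i) j = \<sigma> (M i j)))"

text \<open>Extended by the identity outside \<open>[n]\<close>, so that for even \<open>n \<ge> 2\<close> it is a bijection on all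
  of \<open>nat\<close> and \<open>inv\<close> is its inverse on \<open>[n]\<close>.\<close>

definition fund_perm :: "nat \<Rightarrow> nat \<Rightarrow> nat" where
  "fund_perm n i =
     (if i \<notin> {1..n} then i
      else if i = 1 then 2
      else if i = n then n - 1
      else if even i then i + 2
      else i - 2)"

lemma fund_perm_permutes:
  assumes "even n" and "n \<ge> 2"
  shows "fund_perm n permutes {1..n}"
proof (rule bij_imp_permutes)
  have maps: "fund_perm n ` {1..n} \<subseteq> {1..n}"
    using assms by (auto simp: fund_perm_def elim!: evenE oddE)
  have inj: "inj_on (fund_perm n) {1..n}"
    using assms by (intro inj_onI) (auto simp: fund_perm_def split: if_splits; presburger)
  show "bij_betw (fund_perm n) {1..n} {1..n}"
    unfolding bij_betw_def using inj maps endo_inj_surj by blast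
qed (simp add: fund_perm_def)

definition perm_zpow :: "('a \<Rightarrow> 'a) \<Rightarrow> int \<Rightarrow> 'a \<Rightarrow> 'a" where
  "perm_zpow f e = (if e \<ge> 0 then f ^^ nat e else inv f ^^ nat (- e))"

definition fund_exp :: "nat \<Rightarrow> int" where
  "fund_exp k = (if even k then int (k div 2) else - int (k div 2))"

definition fund_harmonic :: "nat \<Rightarrow> nat \<Rightarrow> nat \<Rightarrow> nat" where
  "fund_harmonic n k j = perm_zpow (fund_perm n) (fund_exp k) j"

text \<open>\<open>R_mu n A\<close> is the matrix of order \<open>n - 2\<close> obtained from the matrix \<open>A\<close> of order \<open>n\<close>.\<close>

definition R_mu :: "nat \<Rightarrow> (nat \<Rightarrow> nat \<Rightarrow> nat) \<Rightarrow> nat \<Rightarrow> nat \<Rightarrow> nat" where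
  "R_mu n A i j = (if i + j \<le> (n - 2) + 1 then A i j else A (i + 2) (j + 2))"

end

theory Submission
  imports Defs "HOL-Number_Theory.Cong"
begin

text \<open>
  The permutation \<open>f\<close> is a single \<open>n\<close>-cycle, and \<open>k\<close> is reached from \<open>1\<close> in \<open>e\<^sub>k\<close> steps. So if the
  symbol \<open>k\<close> is encoded as the residue of \<open>e\<^sub>k\<close> modulo \<open>n\<close>, the fundamental harmonic matrix is the
  addition table \<open>e\<^sub>i + e\<^sub>j\<close> modulo \<open>n\<close>. It is harmonic because the consecutive differences
  \<open>1, -2, 3, -4, \<dots>\<close> of the exponents run through all nonzero residues modulo an even \<open>n\<close>.
  Deleting the band reduces \<open>e\<^sub>i + e\<^sub>j\<close> to a representative in \<open>(-m/2, m/2]\<close> which is congruent to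
  \<open>e\<^sub>i + e\<^sub>j\<close> modulo \<open>m = n - 2\<close>; hence \<open>H\<close> is equal to the fundamental matrix of order \<open>m\<close>.
\<close>

section \<open>Exponents as a complete residue system\<close>

lemma fund_exp_bounds:
  assumes "even n" "k \<in> {1..n}"
  shows "- int n < 2 * fund_exp k" "2 * fund_exp k \<le> int n"
  using assms by (auto simp: fund_exp_def elim!: evenE oddE)

lemma fund_exp_inj:
  assumes "fund_exp i = fund_exp j" "i \<ge> 1" "j \<ge> 1"
  shows "i = j"
  using assms by (auto simp: fund_exp_def elim!: evenE oddE split: if_splits)

lemma fund_exp_surj:
  assumes "even n" "- int n < 2 * v" "2 * v \<le> int n"
  obtains k where "k \<in> {1..n}" "fund_exp k = v"
proof (cases "v > 0")
  case True
  with assms have "nat (2 * v) \<in> {1..n}" "fund_exp (nat (2 * v)) = v"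
    by (auto simp: fund_exp_def nat_mult_distrib)
  then show ?thesis by (rule that)
next
  case False
  then obtain t where t: "v = - int t"
    using nonpos_int_cases[of v] by auto
  with assms have "2 * t + 1 \<in> {1..n}" "fund_exp (2 * t + 1) = v"
    by (auto simp: fund_exp_def elim!: evenE)
  then show ?thesis by (rule that)
qed

text \<open>The exponents of 1, ..., n lie in the half-open interval (-n/2, n/2] of length n, so two
  congruent ones coincide.\<close>

lemma cong_fund_exp_imp_eq:
  assumes "even n" "i \<in> {1..n}" "j \<in> {1..n}" "[fund_exp i = fund_exp j] (mod int n)"
  shows "i = j"
proof -
  have "int n dvd fund_exp i - fund_exp j"
    using assms(4) by (simp add: cong_iff_dvd_diff)
  moreover have "\<bar>fund_exp i - fund_exp j\<bar> < int n"
    using fund_exp_bounds[OF assms(1,2)] fund_exp_bounds[OF assms(1,3)] by linarith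
  ultimately have "fund_exp i = fund_exp j"
    using zdvd_not_zless[of "\<bar>fund_exp i - fund_exp j\<bar>" "int n"] by auto
  then show ?thesis using fund_exp_inj assms by auto
qed

lemma fund_exp_cong_surj:
  assumes "even n" "n \<ge> 2"
  obtains k where "k \<in> {1..n}" "[fund_exp k = z] (mod int n)"
proof -
  define r where "r = z mod int n"
  have r: "0 \<le> r" "r < int n" "[r = z] (mod int n)" "[r - int n = z] (mod int n)"
    using assms by (auto simp: r_def cong_def)
  show ?thesis
  proof (cases "2 * r \<le> int n")
    case True
    then obtain k where "k \<in> {1..n}" "fund_exp k = r"
      using fund_exp_surj[of n r] assms r by auto
    then show ?thesis using that r by blast
  next
    case False
    then obtain k where "k \<in> {1..n}" "fund_exp k = r - int n"
      using fund_exp_surj[of n "r - int n"] assms r by auto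
    then show ?thesis using that[of k] r by simp
  qed
qed

section \<open>The permutation as translation of exponents\<close>

lemma fund_exp_fund_perm:
  assumes "even n" "n \<ge> 2" "i \<in> {1..n}"
  shows "[fund_exp (fund_perm n i) = fund_exp i + 1] (mod int n)"
\<comment> \<open>The only wrap-around: the largest exponent n/2, at i = n, goes to 1 - n/2.
  Elsewhere the equation holds over the integers.\<close>
proof (cases "i = n \<and> i \<noteq> 1")
  case True
  then obtain t where t: "n = 2 * t" "t \<ge> 1"
    using assms by (auto elim!: evenE)
  have "fund_perm n i = Suc (2 * (t - 1))" using True t by (auto simp: fund_perm_def)
  then have "fund_exp (fund_perm n i) = 1 - int t"
    using t by (simp add: fund_exp_def of_nat_diff)
  moreover have "fund_exp i = int t" using True t by (simp add: fund_exp_def)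
  ultimately show ?thesis using t by (simp add: cong_iff_dvd_diff)
next
  case False
  then have "fund_exp (fund_perm n i) = fund_exp i + 1"
    using assms by (auto simp: fund_exp_def fund_perm_def elim!: evenE oddE)
  then show ?thesis by simp
qed

lemma permutes_funpow:
  assumes "f permutes S"
  shows "(f ^^ t) permutes S"
proof (induction t)
  case (Suc t)
  then show ?case unfolding funpow.simps by (rule permutes_compose[OF _ assms])
qed (simp add: permutes_def)

lemma perm_zpow_permutes:
  assumes "f permutes S"
  shows "perm_zpow f z permutes S"
  using assms by (simp add: perm_zpow_def permutes_funpow permutes_inv)

lemma fund_exp_perm_zpow:
  assumes "even n" "n \<ge> 2" "i \<in> {1..n}"
  shows "[fund_exp (perm_zpow (fund_perm n) z i) = fund_exp i + z] (mod int n)"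
proof -
  note P = fund_perm_permutes[OF assms(1,2)]
  have forward: "[fund_exp ((fund_perm n ^^ t) i) = fund_exp i + int t] (mod int n)"
    if "i \<in> {1..n}" for t i
  proof (induction t)
    case (Suc t)
    have "(fund_perm n ^^ t) i \<in> {1..n}"
      using permutes_in_image[OF permutes_funpow[OF P]] that by blast
    from fund_exp_fund_perm[OF assms(1,2) this]
    have "[fund_exp ((fund_perm n ^^ Suc t) i) = fund_exp ((fund_perm n ^^ t) i) + 1] (mod int n)"
      by simp
    also have "[fund_exp ((fund_perm n ^^ t) i) + 1 = (fund_exp i + int t) + 1] (mod int n)"
      using Suc by (intro cong_add cong_refl)
    finally show ?case by (simp add: algebra_simps)
  qed simp
  show ?thesis
  proof (cases "z \<ge> 0")
    case True
    then show ?thesis using forward[OF assms(3), of "nat z"] by (simp add: perm_zpow_def)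
  next
    case False
    define t where "t = nat (- z)"
    \<comment> \<open>Applying the permutation t times to \<open>k\<close> gives back
      \<open>i\<close>, so the law for positive powers at \<open>k\<close> yields the one for
      negative powers at \<open>i\<close>.\<close>
    define k where "k = (inv (fund_perm n) ^^ t) i"
    have "k \<in> {1..n}"
      unfolding k_def
      using permutes_in_image[OF permutes_funpow[OF permutes_inv[OF P]]] assms(3) by blast
    moreover have "(fund_perm n ^^ t) k = i"
      unfolding k_def using permutes_surj[OF P] surj_fn
      by (metis inv_fn permutes_bij[OF P] surj_f_inv_f)
    ultimately have "[fund_exp i = fund_exp k + int t] (mod int n)"
      using forward by metis
    then have "[fund_exp k + int t = fund_exp i] (mod int n)" by (rule cong_sym)
    then have "[fund_exp k = fund_exp i - int t] (mod int n)"
      by (simp add: cong_iff_dvd_diff algebra_simps)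
    then show ?thesis using False by (simp add: perm_zpow_def k_def t_def)
  qed
qed

text \<open>For even n this determines every entry of \<open>M\<close> with indices in [n], so
  showing it for two matrices shows that they agree there. Harmonicity is derived from it
  too.\<close>

definition exp_sum_table :: "nat \<Rightarrow> (nat \<Rightarrow> nat \<Rightarrow> nat) \<Rightarrow> bool" where
  "exp_sum_table n M \<longleftrightarrow> (\<forall>i\<in>{1..n}. \<forall>j\<in>{1..n}. M i j \<in> {1..n} \<and>
     [fund_exp (M i j) = fund_exp i + fund_exp j] (mod int n))"

lemma exp_sum_table_fund_harmonic:
  assumes "even n" "n \<ge> 2"
  shows "exp_sum_table n (fund_harmonic n)"
  unfolding exp_sum_table_def fund_harmonic_def
  using fund_exp_perm_zpow[OF assms]
    permutes_in_image[OF perm_zpow_permutes[OF fund_perm_permutes[OF assms]]]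
  by (auto simp: add.commute)

lemma exp_sum_table_unique:
  assumes "even n" "exp_sum_table n M" "exp_sum_table n N" "i \<in> {1..n}" "j \<in> {1..n}"
  shows "M i j = N i j"
proof (rule cong_fund_exp_imp_eq[OF assms(1)])
  show "M i j \<in> {1..n}" "N i j \<in> {1..n}"
    using assms by (auto simp: exp_sum_table_def)
  show "[fund_exp (M i j) = fund_exp (N i j)] (mod int n)"
    using assms unfolding exp_sum_table_def by (meson cong_sym cong_trans)
qed

section \<open>Harmonicity of addition tables\<close>

lemma fund_exp_Suc_diff:
  "fund_exp (j + 1) - fund_exp j = (if odd j then int j else - int j)"
  by (auto simp: fund_exp_def elim!: evenE oddE)

text \<open>As n is even, congruence modulo n preserves parity. The parity of a step fixes its sign,
  and steps of equal sign differ by less than n.\<close>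

lemma fund_exp_step_inj:
  assumes "even n" "j \<in> {1..n - 1}" "k \<in> {1..n - 1}"
    and "[fund_exp (j + 1) - fund_exp j = fund_exp (k + 1) - fund_exp k] (mod int n)"
  shows "j = k"
proof -
  have d: "int n dvd (if odd j then int j else - int j) - (if odd k then int k else - int k)"
    using assms(4) by (simp only: cong_iff_dvd_diff fund_exp_Suc_diff)
  have "even (int n)" using assms(1) by simp
  then have "even ((if odd j then int j else - int j) - (if odd k then int k else - int k))"
    using d by (rule dvd_trans)
  then have "odd j \<longleftrightarrow> odd k" by (auto split: if_splits)
  then have "int n dvd \<bar>int j - int k\<bar>"
    using d by (auto split: if_splits simp: dvd_diff_commute)
  moreover have "\<bar>int j - int k\<bar> < int n" using assms(2,3) by auto
  ultimately show ?thesis using zdvd_not_zless[of "\<bar>int j - int k\<bar>" "int n"] by auto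
qed

text \<open>An odd residue r is the step at column r. An even nonzero r is the step at column n - r,
  because -(n - r) = r - n.\<close>

lemma fund_exp_step_surj:
  assumes "even n" "n \<ge> 2" "\<not> [d = 0] (mod int n)"
  obtains j where "j \<in> {1..n - 1}" "[fund_exp (j + 1) - fund_exp j = d] (mod int n)"
proof -
  define r where "r = nat (d mod int n)"
  have n: "0 < int n" using assms(2) by simp
  have r: "int r = d mod int n" using n by (simp add: r_def)
  then have "int r < int n" "int r \<noteq> 0"
    using n assms(3) by (simp_all add: cong_def)
  then have rn: "r < n" "r \<noteq> 0" by simp_all
  have rd: "[int r = d] (mod int n)" "[int r - int n = d] (mod int n)"
    using r by (auto simp: cong_def)
  show ?thesis
  proof (cases "odd r")
    case True
    then show ?thesis using that[of r] rn rd unfolding fund_exp_Suc_diff by simp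
  next
    case False
    then have "even (n - r)" "n - r \<in> {1..n - 1}" using assms rn by auto
    then show ?thesis
      using that[of "n - r"] rn rd unfolding fund_exp_Suc_diff by (simp add: of_nat_diff)
  qed
qed

lemma harmonic_matrix_exp_sum_table:
  assumes "even n" "n \<ge> 2" "exp_sum_table n M"
  shows "harmonic_matrix n M"
  unfolding harmonic_matrix_def
proof (intro conjI ballI impI)
  fix i assume i: "i \<in> {1..n}"
  have "bij_betw (fund_harmonic n i) {1..n} {1..n}"
    unfolding fund_harmonic_def
    using permutes_imp_bij[OF perm_zpow_permutes[OF fund_perm_permutes[OF assms(1,2)]]] by simp
  moreover have "fund_harmonic n i j = M i j" if "j \<in> {1..n}" for j
    using exp_sum_table_unique assms exp_sum_table_fund_harmonic[OF assms(1,2)] i that by blast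
  ultimately show "bij_betw (M i) {1..n} {1..n}"
    using bij_betw_cong by blast
next
  fix a b assume a: "a \<in> {1..n}" and b: "b \<in> {1..n}" and "a \<noteq> b"
  let ?e = fund_exp
  have entry: "M i j = a \<longleftrightarrow> [?e i + ?e j = ?e a] (mod int n)"
    if "i \<in> {1..n}" "j \<in> {1..n}" "a \<in> {1..n}" for i j a
    using assms(3) that cong_fund_exp_imp_eq[OF assms(1)] unfolding exp_sum_table_def
    by (metis cong_sym cong_trans)
  \<comment> \<open>Subtracting the two entry conditions eliminates the row: the second congruence
    alone determines \<open>j\<close>, and the first then determines \<open>i\<close>.\<close>
  have pair: "M i j = a \<and> M i (j + 1) = b \<longleftrightarrow>
      [?e i + ?e j = ?e a] (mod int n) \<and> [?e (j + 1) - ?e j = ?e b - ?e a] (mod int n)"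
    if "i \<in> {1..n}" "j \<in> {1..n - 1}" for i j
  proof -
    have "[?e i + ?e (j + 1) = ?e b] (mod int n) \<longleftrightarrow>
        [?e (j + 1) - ?e j = ?e b - ?e a] (mod int n)"
      if *: "[?e i + ?e j = ?e a] (mod int n)"
    proof
      assume "[?e i + ?e (j + 1) = ?e b] (mod int n)"
      from cong_diff[OF this *] show "[?e (j + 1) - ?e j = ?e b - ?e a] (mod int n)" by simp
    next
      assume "[?e (j + 1) - ?e j = ?e b - ?e a] (mod int n)"
      from cong_add[OF this *] show "[?e i + ?e (j + 1) = ?e b] (mod int n)"
        by (simp add: algebra_simps)
    qed
    moreover have "j \<in> {1..n}" "j + 1 \<in> {1..n}" using that by auto
    ultimately show ?thesis using entry that(1) a b by blast
  qed
  have "\<not> [?e b - ?e a = 0] (mod int n)"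
    using cong_fund_exp_imp_eq[OF assms(1) b a] \<open>a \<noteq> b\<close> by (auto simp: cong_iff_dvd_diff)
  then obtain j where j: "j \<in> {1..n - 1}" "[?e (j + 1) - ?e j = ?e b - ?e a] (mod int n)"
    using fund_exp_step_surj assms by blast
  obtain i where i: "i \<in> {1..n}" "[?e i = ?e a - ?e j] (mod int n)"
    using fund_exp_cong_surj assms by blast
  have ij: "[?e i + ?e j = ?e a] (mod int n)"
    using cong_add[OF i(2) cong_refl[of "?e j"]] by simp
  show "\<exists>!(i, j). i \<in> {1..n} \<and> j \<in> {1..n - 1} \<and> M i j = a \<and> M i (j + 1) = b"
  proof (rule ex1I[of _ "(i, j)"])
    show "case (i, j) of (i, j) \<Rightarrow> i \<in> {1..n} \<and> j \<in> {1..n - 1} \<and> M i j = a \<and> M i (j + 1) = b"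
      using pair i(1) j ij by simp
  next
    fix p assume p: "case p of (i, j) \<Rightarrow> i \<in> {1..n} \<and> j \<in> {1..n - 1} \<and> M i j = a \<and> M i (j + 1) = b"
    obtain i' j' where [simp]: "p = (i', j')" by force
    have i': "i' \<in> {1..n}" and j': "j' \<in> {1..n - 1}"
      and p1: "[?e i' + ?e j' = ?e a] (mod int n)"
      and p2: "[?e (j' + 1) - ?e j' = ?e b - ?e a] (mod int n)"
      using p pair by auto
    have "j' = j"
      using fund_exp_step_inj[OF assms(1) j' j(1)] p2 j(2) by (meson cong_sym cong_trans)
    then have "[?e i' + ?e j = ?e i + ?e j] (mod int n)"
      using p1 ij by (meson cong_sym cong_trans)
    then have "[?e i' = ?e i] (mod int n)" by (simp add: cong_add_rcancel)
    then show "p = (i, j)"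
      using cong_fund_exp_imp_eq[OF assms(1) i' i(1)] \<open>j' = j\<close> by simp
  qed
qed

section \<open>Removal of the band\<close>

lemma fund_exp_add_upper_bounds:
  assumes "even m" "i \<in> {1..m}" "j \<in> {1..m}" "i + j \<le> m + 1"
  shows "- int m < 2 * (fund_exp i + fund_exp j)" "2 * (fund_exp i + fund_exp j) \<le> int m"
  using assms by (auto simp: fund_exp_def elim!: evenE oddE; presburger)+

lemma fund_exp_add_lower_reduce:
  assumes "even m" "i \<in> {1..m}" "j \<in> {1..m}" "i + j \<ge> m + 2"
  obtains c where "fund_exp (i + 2) + fund_exp (j + 2) + c * (int m + 2) =
      fund_exp i + fund_exp j + c * int m"
    and "- int m < 2 * (fund_exp i + fund_exp j + c * int m)"
    and "2 * (fund_exp i + fund_exp j + c * int m) \<le> int m"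
proof
  \<comment> \<open>Raising an index by 2 adds 1 to its exponent if it is even and subtracts 1 if it
    is odd, so the sum changes by -2c. This is offset by the difference between c(m + 2) and cm.
    Only indices of equal parity leave the interval (-m/2, m/2], and one period brings them
    back.\<close>
  define c :: int where "c = (if even i \<and> even j then -1 else if odd i \<and> odd j then 1 else 0)"
  show "fund_exp (i + 2) + fund_exp (j + 2) + c * (int m + 2) =
      fund_exp i + fund_exp j + c * int m"
    by (auto simp: c_def fund_exp_def)
  show "- int m < 2 * (fund_exp i + fund_exp j + c * int m)"
    using assms by (auto simp: c_def fund_exp_def elim!: evenE oddE)
  show "2 * (fund_exp i + fund_exp j + c * int m) \<le> int m"
    using assms by (auto simp: c_def fund_exp_def elim!: evenE oddE)
qed

lemma exp_sum_table_R_mu: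
  assumes "even m" "exp_sum_table (m + 2) A"
  shows "exp_sum_table m (R_mu (m + 2) A)"
  unfolding exp_sum_table_def
proof (intro ballI)
  fix i j assume i: "i \<in> {1..m}" and j: "j \<in> {1..m}"
  let ?H = "R_mu (m + 2) A i j" and ?s = "fund_exp i + fund_exp j"
  \<comment> \<open>One integer serves both moduli: modulo m + 2 it identifies the entry, modulo m
    it is the required sum. Its range makes it the exponent of a symbol in [m], which rules out the
    entries m + 1 and m + 2.\<close>
  obtain v where v: "- int m < 2 * v" "2 * v \<le> int m" "[v = ?s] (mod int m)"
    and H: "?H \<in> {1..m + 2}" "[fund_exp ?H = v] (mod int (m + 2))"
  proof (cases "i + j \<le> m + 1")
    case True
    then have "?H = A i j" by (simp add: R_mu_def)
    then show ?thesis
      using that[of ?s] fund_exp_add_upper_bounds[OF assms(1) i j True] assms(2) i j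
      unfolding exp_sum_table_def by simp
  next
    case False
    then obtain c where c: "fund_exp (i + 2) + fund_exp (j + 2) + c * (int m + 2) = ?s + c * int m"
      and b: "- int m < 2 * (?s + c * int m)" "2 * (?s + c * int m) \<le> int m"
      using fund_exp_add_lower_reduce[OF assms(1) i j] by auto
    have "i + 2 \<in> {1..m + 2}" "j + 2 \<in> {1..m + 2}" using i j by auto
    moreover have "?H = A (i + 2) (j + 2)" using False by (simp add: R_mu_def)
    ultimately have H: "?H \<in> {1..m + 2}"
      "[fund_exp ?H = fund_exp (i + 2) + fund_exp (j + 2)] (mod int (m + 2))"
      using assms(2) unfolding exp_sum_table_def by metis+
    have "[fund_exp (i + 2) + fund_exp (j + 2) = ?s + c * int m] (mod int (m + 2))"
      unfolding c[symmetric] by (simp add: cong_iff_dvd_diff add.commute)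
    with H(2) have "[fund_exp ?H = ?s + c * int m] (mod int (m + 2))" by (rule cong_trans)
    moreover have "[?s + c * int m = ?s] (mod int m)" by (simp add: cong_iff_dvd_diff)
    ultimately show ?thesis using that b H(1) by blast
  qed
  obtain k where k: "k \<in> {1..m}" "fund_exp k = v"
    using fund_exp_surj[OF assms(1) v(1,2)] .
  have "?H = k"
    using cong_fund_exp_imp_eq[of "m + 2" ?H k] H k assms(1) by auto
  then show "?H \<in> {1..m} \<and> [fund_exp ?H = ?s] (mod int m)" using k v by simp
qed

theorem theorem2:
  fixes n m :: nat and A H :: "nat \<Rightarrow> nat \<Rightarrow> nat"
  assumes "even n" and "n \<ge> 4"
    and "m = n - 2"
    and "A = fund_harmonic n"
    and "H = R_mu n A"
  shows "harmonic_matrix m H \<and> harmonic_iso m H (fund_harmonic (n - 2))"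
proof -
  have n: "n = m + 2" and m: "even m" "m \<ge> 2" using assms by auto
  have "exp_sum_table (m + 2) (fund_harmonic (m + 2))"
    using m by (intro exp_sum_table_fund_harmonic) auto
  then have H: "exp_sum_table m H"
    unfolding assms(4,5) n by (rule exp_sum_table_R_mu[OF m(1)])
  note F = exp_sum_table_fund_harmonic[OF m]
  have "\<forall>i\<in>{1..m}. \<forall>j\<in>{1..m}. fund_harmonic m (id i) j = id (H i j)"
    using exp_sum_table_unique[OF m(1) F H] by simp
  then have "harmonic_iso m H (fund_harmonic m)"
    unfolding harmonic_iso_def
    using harmonic_matrix_exp_sum_table[OF m H] harmonic_matrix_exp_sum_table[OF m F]
      permutes_id[of "{1..m}"] by blast
  then show ?thesis
    using harmonic_matrix_exp_sum_table[OF m H] assms(3) by simp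
qed

end
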